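(* Let $(K_n)_{n=1}^\infty$ be the optimal constants satisfying the multilinear Bohnenblust--Hille inequality for real scalars. Then $$K_{n+1}-K_n<\frac{0.87}{n^{0.473678}}$$ for infinitely many positive integers $n$.
   Context: For a positive integer $n$, $K_n$ denotes the optimal constant in the real $n$-linear Bohnenblust--Hille inequality, i.e. the smallest $C\in[1,\infty)$ such that $$\left(\sum_{i_1,\ldots,i_n=1}^N |U(e_{i_1},\ldots,e_{i_n})|^{\frac{2n}{n+1}}\right)^{\frac{n+1}{2n}}\le C\,\sup|U(z_1,\ldots,z_n)|$$ for all positive integers $N$ and all $n$-linear forms $U:\mathbb{R}^N\times\cdots\times\mathbb{R}^N\to\mathbb{R}$, where $(e_i)_{i=1}^N$ is the canonical basis of $\mathbb{R}^N$ and the supremum is over all $z_1,\ldots,z_n$ in the open unit ball of $\mathbb{R}^N$ with the sup norm. Such finite constants exist (Bohnenblust--Hille theorem). *)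

theory Defs
  imports Complex_Main "Jordan_Normal_Form.Matrix"
begin

text \<open>
  The space of real \<open>N\<close>-tuples is the carrier \<^term>\<open>carrier_vec N :: real vec set\<close>, and an
  \<open>n\<close>-tuple of vectors is a list of length \<open>n\<close>. Indices range over \<open>0, \<dots>, N - 1\<close>.
\<close>

definition vec_tuples :: "nat \<Rightarrow> nat \<Rightarrow> real vec list set" where
  "vec_tuples n N = {zs. length zs = n \<and> set zs \<subseteq> carrier_vec N}"

text \<open>The values of \<open>U\<close> outside \<^term>\<open>vec_tuples n N\<close> are irrelevant.\<close>

definition multilinear_form :: "nat \<Rightarrow> nat \<Rightarrow> (real vec list \<Rightarrow> real) \<Rightarrow> bool" where
  "multilinear_form n N U \<longleftrightarrow>
     (\<forall>zs \<in> vec_tuples n N. \<forall>k < n. \<forall>x \<in> carrier_vec N. \<forall>y \<in> carrier_vec N. \<forall>a b :: real.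
        U (zs[k := a \<cdot>\<^sub>v x + b \<cdot>\<^sub>v y]) = a * U (zs[k := x]) + b * U (zs[k := y]))"

text \<open>Only used for vectors of positive dimension.\<close>

definition sup_norm_vec :: "real vec \<Rightarrow> real" where
  "sup_norm_vec v = Max ((\<lambda>j. \<bar>v $ j\<bar>) ` {..<dim_vec v})"

definition open_unit_ball :: "nat \<Rightarrow> real vec set" where
  "open_unit_ball N = {z \<in> carrier_vec N. sup_norm_vec z < 1}"

text \<open>
  For \<open>N > 0\<close> and a multilinear form \<open>U\<close> the supremum is over a nonempty bounded set of reals.
\<close>

definition form_sup :: "nat \<Rightarrow> nat \<Rightarrow> (real vec list \<Rightarrow> real) \<Rightarrow> real" where
  "form_sup n N U = (SUP zs \<in> {zs. length zs = n \<and> set zs \<subseteq> open_unit_ball N}. \<bar>U zs\<bar>)"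

definition coeff_norm :: "nat \<Rightarrow> nat \<Rightarrow> (real vec list \<Rightarrow> real) \<Rightarrow> real" where
  "coeff_norm n N U =
     (\<Sum>is \<in> {is. length is = n \<and> set is \<subseteq> {..<N}}.
        \<bar>U (map (unit_vec N) is)\<bar> powr (2 * real n / (real n + 1)))
       powr ((real n + 1) / (2 * real n))"

definition BH_inequality :: "nat \<Rightarrow> real \<Rightarrow> bool" where
  "BH_inequality n C \<longleftrightarrow>
     (\<forall>N > 0. \<forall>U. multilinear_form n N U \<longrightarrow> coeff_norm n N U \<le> C * form_sup n N U)"

definition BH_const :: "nat \<Rightarrow> real" where
  "BH_const n = (LEAST C. 1 \<le> C \<and> BH_inequality n C)"

end

theory Submission
  imports Defs "HOL-Analysis.Convex" "HOL-Real_Asymp.Real_Asymp"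
begin

text \<open>
  Write \<open>K\<^sub>n\<close> for the optimal constant. The heart of the matter is the recursion
  \<open>K\<^sub>n\<^sub>+\<^sub>1 \<le> (8 / 3) powr (1 / (2 * n)) * K\<^sub>n\<close>. Since \<open>8 / 3 < exp 1\<close>, it telescopes to
  \<open>K\<^sub>n\<^sub>+\<^sub>1 \<le> sqrt (exp 1 * n)\<close> (\<open>BH_inequality_sqrt\<close>). If all but finitely many increments were at
  least \<open>0.87 / n powr 0.473678\<close>, then adding those between \<open>n\<close> and \<open>2 * n\<close> would bound \<open>K\<^sub>2\<^sub>n\<close> from below
  by a positive multiple of \<open>n powr 0.526322\<close>, which outgrows the square root.

  The recursion (\<open>BH_inequality_Suc\<close>) is the interpolation argument of Bayart, Pellegrino and
  Seoane-Sepulveda. Put \<open>p = 2 * n / (n + 1)\<close>, the exponent of the inequality for \<open>n\<close>-linear forms. If a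
  sign vector is inserted into slot \<open>j\<close> of an \<open>(n + 1)\<close>-linear form, the result is an \<open>n\<close>-linear form
  whose coefficients are Rademacher sums. Averaging the \<open>n\<close>-linear inequality over the signs, and
  Khinchine's inequality, bound the mixed norm of the coefficients that is \<open>\<ell>\<^sub>2\<close> in slot \<open>j\<close> and
  \<open>\<ell>\<^sub>p\<close> in the others. The \<open>n + 1\<close> norms for the different slots are interpolated
  (\<open>mixed_norm_interpolation\<close>, after a use of Minkowski's inequality in \<open>mixed_norm_insert_2_le\<close>) to
  the \<open>\<ell>\<^sub>r\<close> norm, where \<open>r = 2 * (n + 1) / (n + 2)\<close> is the exponent for \<open>n + 1\<close>.

  A Khinchine constant \<open>c powr ((2 - p) / p)\<close> costs a factor \<open>c powr (1 / n)\<close> in each step and makes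
  \<open>K\<^sub>n\<close> grow at most like \<open>n powr (ln c)\<close>, so some \<open>c\<close> with \<open>ln c < 0.526322\<close> is needed. The
  comparison of the second with the fourth moment gives \<open>c = sqrt 3\<close>, which is slightly too large. A
  sharper comparison with the third moment (\<open>sign_sum_third_moment\<close>) gives \<open>c = sqrt (8 / 3)\<close>, with
  \<open>ln c < 1 / 2\<close>.
\<close>

section \<open>Inequalities for finite sums\<close>

text \<open>
  Apply the convex function \<open>exp\<close> to the weighted mean of the logarithms.
\<close>

lemma weighted_AM_GM:
  fixes x w :: "'a \<Rightarrow> real"
  assumes "finite J" and w: "\<And>j. j \<in> J \<Longrightarrow> w j > 0" and "(\<Sum>j\<in>J. w j) = 1"
    and x: "\<And>j. j \<in> J \<Longrightarrow> x j \<ge> 0"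
  shows "(\<Prod>j\<in>J. x j powr w j) \<le> (\<Sum>j\<in>J. w j * x j)"
proof (cases "\<exists>j\<in>J. x j = 0")
  case True
  then have "(\<Prod>j\<in>J. x j powr w j) = 0" using assms(1) by (auto intro!: prod_zero)
  also have "0 \<le> (\<Sum>j\<in>J. w j * x j)"
    using w x by (intro sum_nonneg mult_nonneg_nonneg) (auto simp: less_imp_le)
  finally show ?thesis .
next
  case False
  then have pos: "x j > 0" if "j \<in> J" for j using x[OF that] that by force
  have "J \<noteq> {}" using assms(3) by auto
  have "(\<Prod>j\<in>J. x j powr w j) = exp (\<Sum>j\<in>J. w j *\<^sub>R ln (x j))"
    unfolding exp_sum[OF assms(1)] using pos by (intro prod.cong) (force simp: powr_def)+
  also have "\<dots> \<le> (\<Sum>j\<in>J. w j * exp (ln (x j)))"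
    using w by (intro convex_on_sum[OF assms(1) \<open>J \<noteq> {}\<close> exp_convex assms(3)]) (auto simp: less_imp_le)
  also have "\<dots> = (\<Sum>j\<in>J. w j * x j)" using pos by (intro sum.cong) auto
  finally show ?thesis .
qed

text \<open>
  Hoelder's inequality for any finite number of factors: after each \<open>h j\<close> is scaled to have sum one,
  the weighted arithmetic-geometric mean inequality bounds the left side term by term.
\<close>

lemma Hoelder_prod:
  fixes w :: "'a \<Rightarrow> real" and h :: "'a \<Rightarrow> 'b \<Rightarrow> real"
  assumes "finite J" and w: "\<And>j. j \<in> J \<Longrightarrow> w j > 0" and w1: "(\<Sum>j\<in>J. w j) = 1"
    and h: "\<And>j i. j \<in> J \<Longrightarrow> i \<in> I \<Longrightarrow> h j i \<ge> 0" and "finite I"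
  shows "(\<Sum>i\<in>I. \<Prod>j\<in>J. h j i powr w j) \<le> (\<Prod>j\<in>J. (\<Sum>i\<in>I. h j i) powr w j)"
proof (cases "\<exists>j\<in>J. (\<Sum>i\<in>I. h j i) = 0")
  case True
  then obtain j where j: "j \<in> J" "(\<Sum>i\<in>I. h j i) = 0" by auto
  then have "h j i = 0" if "i \<in> I" for i
    using sum_nonneg_eq_0_iff[OF assms(5), of "h j"] h that by blast
  then have "(\<Prod>j\<in>J. h j i powr w j) = 0" if "i \<in> I" for i
    using j assms(1) that by (intro prod_zero) auto
  then have "(\<Sum>i\<in>I. \<Prod>j\<in>J. h j i powr w j) = 0" by simp
  also have "0 \<le> (\<Prod>j\<in>J. (\<Sum>i\<in>I. h j i) powr w j)" by (intro prod_nonneg) auto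
  finally show ?thesis .
next
  case False
  define H where "H j = (\<Sum>i\<in>I. h j i)" for j
  have H: "H j > 0" if "j \<in> J" for j
    using False that sum_nonneg[of I "h j"] h[OF that] unfolding H_def by force
  define P where "P = (\<Prod>j\<in>J. H j powr w j)"
  have P: "P > 0" unfolding P_def using H by (intro prod_pos) force
  have "(\<Sum>i\<in>I. (\<Prod>j\<in>J. h j i powr w j) / P) = (\<Sum>i\<in>I. \<Prod>j\<in>J. (h j i / H j) powr w j)"
    unfolding P_def prod_dividef[symmetric] using h H
    by (intro sum.cong prod.cong) (auto simp: powr_divide less_imp_le)
  also have "\<dots> \<le> (\<Sum>i\<in>I. \<Sum>j\<in>J. w j * (h j i / H j))"
    using w w1 h H by (intro sum_mono weighted_AM_GM assms(1)) (auto simp: less_imp_le)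
  also have "\<dots> = (\<Sum>j\<in>J. w j * (H j / H j))"
    by (subst sum.swap) (simp only: H_def sum_distrib_left[symmetric] sum_divide_distrib[symmetric])
  also have "\<dots> = (\<Sum>j\<in>J. w j)" using H by (intro sum.cong) force+
  finally have "(\<Sum>i\<in>I. \<Prod>j\<in>J. h j i powr w j) / P \<le> 1" using w1 by (simp add: sum_divide_distrib)
  then show ?thesis using P unfolding P_def H_def by (simp add: divide_le_eq)
qed

lemma Hoelder_powr:
  fixes f g :: "'b \<Rightarrow> real"
  assumes "finite I" and "0 < w" "w < 1"
    and "\<And>i. i \<in> I \<Longrightarrow> f i \<ge> 0" "\<And>i. i \<in> I \<Longrightarrow> g i \<ge> 0"
  shows "(\<Sum>i\<in>I. f i powr w * g i powr (1 - w)) \<le> (\<Sum>i\<in>I. f i) powr w * (\<Sum>i\<in>I. g i) powr (1 - w)"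
  using Hoelder_prod[of "{True, False}" "\<lambda>b. if b then w else 1 - w" I "\<lambda>b. if b then f else g"] assms
  by simp

text \<open>
  The triangle inequality in \<open>\<ell>\<^sub>t\<close>. With \<open>s = (\<Sum>l. c _ l)\<close>, write \<open>s powr t = s * s powr (t - 1)\<close>,
  expand the first factor and apply Hoelder to each summand.
\<close>

lemma Minkowski_powr:
  fixes c :: "'a \<Rightarrow> 'b \<Rightarrow> real"
  assumes "finite I" and "t > 1" and c: "\<And>i l. i \<in> I \<Longrightarrow> l \<in> L \<Longrightarrow> c i l \<ge> 0"
  shows "(\<Sum>i\<in>I. (\<Sum>l\<in>L. c i l) powr t) powr (1 / t) \<le> (\<Sum>l\<in>L. (\<Sum>i\<in>I. c i l powr t) powr (1 / t))"
proof -
  define s where "s i = (\<Sum>l\<in>L. c i l)" for i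
  define S where "S = (\<Sum>i\<in>I. s i powr t)"
  define R where "R = (\<Sum>l\<in>L. (\<Sum>i\<in>I. c i l powr t) powr (1 / t))"
  have s: "s i \<ge> 0" if "i \<in> I" for i unfolding s_def using c that by (intro sum_nonneg) auto
  have R: "R \<ge> 0" unfolding R_def by (intro sum_nonneg) auto
  have "S \<ge> 0" unfolding S_def by (intro sum_nonneg) auto
  show ?thesis
  proof (cases "S = 0")
    case True
    then show ?thesis using R unfolding S_def R_def s_def by simp
  next
    case False
    with \<open>S \<ge> 0\<close> have S: "S > 0" by simp
    have root: "(x powr t) powr (1 / t) = x" and root': "(x powr t) powr (1 - 1 / t) = x powr (t - 1)"
      if "x \<ge> 0" for x :: real
      using that assms(2) by (auto simp: powr_powr right_diff_distrib)
    have "S = (\<Sum>i\<in>I. s i * s i powr (t - 1))"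
      unfolding S_def using s by (intro sum.cong refl) (simp add: powr_mult_base)
    also have "\<dots> = (\<Sum>i\<in>I. \<Sum>l\<in>L. c i l * s i powr (t - 1))"
      unfolding sum_distrib_right[symmetric] by (simp add: s_def)
    also have "\<dots> = (\<Sum>l\<in>L. \<Sum>i\<in>I. c i l * s i powr (t - 1))"
      by (rule sum.swap)
    also have "\<dots> = (\<Sum>l\<in>L. \<Sum>i\<in>I. (c i l powr t) powr (1 / t) * (s i powr t) powr (1 - 1 / t))"
      using s c by (intro sum.cong refl) (simp add: root root')
    also have "\<dots> \<le> (\<Sum>l\<in>L. (\<Sum>i\<in>I. c i l powr t) powr (1 / t) * S powr (1 - 1 / t))"
      unfolding S_def using assms(1,2) by (intro sum_mono Hoelder_powr) auto
    also have "\<dots> = R * S powr (1 - 1 / t)" by (simp add: R_def sum_distrib_right)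
    finally have "S powr 1 \<le> R * S powr (1 - 1 / t)" using S by simp
    moreover have "S powr 1 = S powr (1 / t) * S powr (1 - 1 / t)"
      by (simp only: powr_add[symmetric]) simp
    ultimately have "S powr (1 / t) * S powr (1 - 1 / t) \<le> R * S powr (1 - 1 / t)" by simp
    then have "S powr (1 / t) \<le> R" by (rule mult_right_le_imp_le) (use S in simp)
    then show ?thesis unfolding S_def R_def s_def .
  qed
qed

section \<open>Khinchine's inequality with exponents close to 2\<close>

text \<open>
  Rademacher sums: a subset \<open>A\<close> of \<open>I\<close> encodes the choice of signs that is positive exactly on \<open>A\<close>,
  so expectations are sums over \<^term>\<open>Pow I\<close> divided by \<open>2 ^ card I\<close>.
\<close>

definition sign_sum :: "'a set \<Rightarrow> ('a \<Rightarrow> real) \<Rightarrow> 'a set \<Rightarrow> real" where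
  "sign_sum I a A = (\<Sum>i\<in>I. if i \<in> A then a i else - a i)"

lemma sum_Pow_split:
  fixes F :: "'a set \<Rightarrow> real"
  assumes "finite I" "i \<in> I"
  shows "(\<Sum>A\<in>Pow I. F A) = (\<Sum>B\<in>Pow (I - {i}). F B + F (insert i B))"
proof -
  have eq: "Pow I = Pow (I - {i}) \<union> insert i ` Pow (I - {i})"
    using Pow_insert[of i "I - {i}"] assms(2) by (simp add: insert_absorb)
  have "(\<Sum>A\<in>Pow I. F A) = (\<Sum>A\<in>Pow (I - {i}). F A) + (\<Sum>A\<in>insert i ` Pow (I - {i}). F A)"
    unfolding eq using assms(1) by (intro sum.union_disjoint) auto
  also have "(\<Sum>A\<in>insert i ` Pow (I - {i}). F A) = (\<Sum>A\<in>Pow (I - {i}). F (insert i A))"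
    by (subst sum.reindex) (auto intro!: inj_onI)
  finally show ?thesis by (simp add: sum.distrib)
qed

text \<open>
  A discrete form of Gaussian integration by parts, \<open>E (X \<phi>(X)) \<le> \<sigma>\<^sup>2 E \<phi>'(X)\<close>: expand the factor \<open>X\<close>
  and average over the sign of its \<open>i\<close>-th term first. The hypothesis on \<open>\<phi>\<close> and \<open>\<psi>\<close> holds for
  \<open>\<psi> = \<phi>'\<close> whenever \<open>\<phi>'\<close> is convex, because then the mean of \<open>\<phi>'\<close> over \<open>[y - x, y + x]\<close> is at most the
  mean of its values at the end points.
\<close>

lemma sign_sum_integration_by_parts:
  fixes a :: "'a \<Rightarrow> real" and \<phi> \<psi> :: "real \<Rightarrow> real"
  assumes "finite I"
    and step: "\<And>x y. x * (\<phi> (y + x) - \<phi> (y - x)) \<le> x\<^sup>2 * (\<psi> (y + x) + \<psi> (y - x))"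
  shows "(\<Sum>A\<in>Pow I. sign_sum I a A * \<phi> (sign_sum I a A))
           \<le> (\<Sum>i\<in>I. (a i)\<^sup>2) * (\<Sum>A\<in>Pow I. \<psi> (sign_sum I a A))"
proof -
  have "(\<Sum>A\<in>Pow I. sign_sum I a A * \<phi> (sign_sum I a A))
      = (\<Sum>A\<in>Pow I. \<Sum>i\<in>I. (if i \<in> A then a i else - a i) * \<phi> (sign_sum I a A))"
    by (simp add: sign_sum_def sum_distrib_right)
  also have "\<dots> = (\<Sum>i\<in>I. \<Sum>A\<in>Pow I. (if i \<in> A then a i else - a i) * \<phi> (sign_sum I a A))"
    by (rule sum.swap)
  also have "\<dots> \<le> (\<Sum>i\<in>I. (a i)\<^sup>2 * (\<Sum>A\<in>Pow I. \<psi> (sign_sum I a A)))"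
  proof (rule sum_mono)
    fix i assume i: "i \<in> I"
    let ?Y = "sign_sum (I - {i}) a"
    have out: "sign_sum I a B = ?Y B - a i" and ins: "sign_sum I a (insert i B) = ?Y B + a i"
      if "B \<in> Pow (I - {i})" for B
    proof -
      have "i \<notin> B" using that by auto
      then show "sign_sum I a B = ?Y B - a i"
        unfolding sign_sum_def using assms(1) i by (simp add: sum.remove)
      have "(\<Sum>k\<in>I - {i}. if k \<in> insert i B then a k else - a k) = ?Y B"
        unfolding sign_sum_def by (intro sum.cong) auto
      then show "sign_sum I a (insert i B) = ?Y B + a i"
        unfolding sign_sum_def[of I] using assms(1) i by (simp add: sum.remove)
    qed
    have "(\<Sum>A\<in>Pow I. (if i \<in> A then a i else - a i) * \<phi> (sign_sum I a A))
        = (\<Sum>B\<in>Pow (I - {i}). a i * (\<phi> (?Y B + a i) - \<phi> (?Y B - a i)))"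
      unfolding sum_Pow_split[OF assms(1) i]
      by (intro sum.cong refl) (use out ins in \<open>auto simp: right_diff_distrib\<close>)
    also have "\<dots> \<le> (\<Sum>B\<in>Pow (I - {i}). (a i)\<^sup>2 * (\<psi> (?Y B + a i) + \<psi> (?Y B - a i)))"
      by (intro sum_mono step)
    also have "\<dots> = (a i)\<^sup>2 * (\<Sum>A\<in>Pow I. \<psi> (sign_sum I a A))"
      unfolding sum_Pow_split[OF assms(1) i] sum_distrib_left
      by (intro sum.cong refl) (use out ins in \<open>auto simp: add.commute\<close>)
    finally show "(\<Sum>A\<in>Pow I. (if i \<in> A then a i else - a i) * \<phi> (sign_sum I a A))
        \<le> (a i)\<^sup>2 * (\<Sum>A\<in>Pow I. \<psi> (sign_sum I a A))" .
  qed
  finally show ?thesis by (simp add: sum_distrib_right)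
qed

lemma sign_sum_second_moment:
  fixes a :: "'a \<Rightarrow> real"
  assumes "finite I"
  shows "(\<Sum>A\<in>Pow I. (sign_sum I a A)\<^sup>2) = 2 ^ card I * (\<Sum>i\<in>I. (a i)\<^sup>2)"
proof (rule antisym)
  show "(\<Sum>A\<in>Pow I. (sign_sum I a A)\<^sup>2) \<le> 2 ^ card I * (\<Sum>i\<in>I. (a i)\<^sup>2)"
    using sign_sum_integration_by_parts[OF assms, of "\<lambda>x. x" "\<lambda>x. 1" a] assms
    by (simp add: power2_eq_square algebra_simps card_Pow)
  show "2 ^ card I * (\<Sum>i\<in>I. (a i)\<^sup>2) \<le> (\<Sum>A\<in>Pow I. (sign_sum I a A)\<^sup>2)"
    using sign_sum_integration_by_parts[OF assms, of "\<lambda>x. -x" "\<lambda>x. -1" a] assms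
    by (simp add: power2_eq_square algebra_simps card_Pow sum_negf)
qed

text \<open>
  Integration by parts with \<open>\<phi>(x) = x\<^sup>3\<close> and \<open>\<phi>(x) = x \<bar>x\<bar>\<close> gives \<open>E X\<^sup>4 \<le> 3 \<sigma>\<^sup>4\<close> and
  \<open>E \<bar>X\<bar>\<^sup>3 \<le> 2 \<sigma>\<^sup>2 E \<bar>X\<bar>\<close>. The first alone would yield, by Cauchy-Schwarz, only the constant \<open>sqrt 3\<close>
  here. Combined with the second it gives \<open>sqrt (8 / 3)\<close>, close to the Gaussian value
  \<open>2 * sqrt (2 / pi)\<close>: the expectation of a square \<open>(X\<^sup>2 - c \<sigma> \<bar>X\<bar> + d \<sigma>\<^sup>2)\<^sup>2\<close> is nonnegative, and
  \<open>c = sqrt 6\<close>, \<open>d = 1\<close> is the best choice.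
\<close>

lemma sign_sum_third_moment:
  fixes a :: "'a \<Rightarrow> real"
  assumes "finite I" and \<sigma>: "\<sigma> > 0" "\<sigma>\<^sup>2 = (\<Sum>i\<in>I. (a i)\<^sup>2)"
  shows "(\<Sum>A\<in>Pow I. \<bar>sign_sum I a A\<bar> ^ 3) \<le> 2 ^ card I * (sqrt (8 / 3) * \<sigma> ^ 3)"
proof -
  let ?X = "sign_sum I a"
  define M where "M k = (\<Sum>A\<in>Pow I. \<bar>?X A\<bar> ^ k)" for k
  have M2: "M 2 = 2 ^ card I * \<sigma>\<^sup>2"
    using sign_sum_second_moment[OF assms(1)] by (simp add: M_def \<sigma>(2))
  have M4: "M 4 \<le> \<sigma>\<^sup>2 * (3 * M 2)"
  proof -
    have "x * ((y + x) ^ 3 - (y - x) ^ 3) \<le> x\<^sup>2 * (3 * (y + x)\<^sup>2 + 3 * (y - x)\<^sup>2)" for x y :: real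
    proof -
      have "x\<^sup>2 * (3 * (y + x)\<^sup>2 + 3 * (y - x)\<^sup>2) - x * ((y + x) ^ 3 - (y - x) ^ 3) = 4 * x ^ 4"
        by (simp add: power2_eq_square power3_eq_cube power4_eq_xxxx algebra_simps)
      moreover have "4 * x ^ 4 \<ge> 0" by simp
      ultimately show ?thesis by linarith
    qed
    from sign_sum_integration_by_parts[OF assms(1), of "\<lambda>x. x ^ 3" "\<lambda>x. 3 * x\<^sup>2", OF this, of a]
    show ?thesis
      by (simp add: M_def \<sigma>(2) sum_distrib_left power_even_abs power_Suc[symmetric] del: power_Suc)
  qed
  have M31: "M 3 \<le> \<sigma>\<^sup>2 * (2 * M 1)"
  proof -
    have "x * ((y + x) * \<bar>y + x\<bar> - (y - x) * \<bar>y - x\<bar>) \<le> x\<^sup>2 * (2 * \<bar>y + x\<bar> + 2 * \<bar>y - x\<bar>)" for x y :: real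
    proof -
      have "(u - v) * (u * \<bar>u\<bar> - v * \<bar>v\<bar>) \<le> (u - v)\<^sup>2 * (\<bar>u\<bar> + \<bar>v\<bar>)" for u v :: real
      proof -
        have "(u - v)\<^sup>2 * (\<bar>u\<bar> + \<bar>v\<bar>) - (u - v) * (u * \<bar>u\<bar> - v * \<bar>v\<bar>)
            = (u - v) * (u * \<bar>v\<bar> - v * \<bar>u\<bar>)"
          by (simp add: power2_eq_square algebra_simps)
        also have "\<dots> \<ge> 0"
          by (cases "u \<ge> 0"; cases "v \<ge> 0")
             (auto simp: abs_if zero_le_mult_iff mult_le_0_iff intro: mult_nonneg_nonneg mult_nonpos_nonpos)
        finally show ?thesis by linarith
      qed
      from this[of "y + x" "y - x"] show ?thesis
        by (simp add: power2_eq_square algebra_simps)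
    qed
    from sign_sum_integration_by_parts[OF assms(1), of "\<lambda>x. x * \<bar>x\<bar>" "\<lambda>x. 2 * \<bar>x\<bar>", OF this, of a]
    show ?thesis
      by (simp add: M_def \<sigma>(2) sum_distrib_left power3_eq_cube abs_mult_self mult.assoc[symmetric])
  qed
  have "0 \<le> (\<Sum>A\<in>Pow I. (\<bar>?X A\<bar>\<^sup>2 - sqrt 6 * \<sigma> * \<bar>?X A\<bar> + \<sigma>\<^sup>2)\<^sup>2)"
    by (intro sum_nonneg) auto
  also have "\<dots> = (\<Sum>A\<in>Pow I. \<bar>?X A\<bar> ^ 4 - 2 * sqrt 6 * \<sigma> * \<bar>?X A\<bar> ^ 3 + 8 * \<sigma>\<^sup>2 * \<bar>?X A\<bar>\<^sup>2
       - 2 * sqrt 6 * \<sigma> ^ 3 * \<bar>?X A\<bar> ^ 1 + \<sigma> ^ 4)"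
  proof (intro sum.cong refl)
    fix A
    have "(x\<^sup>2 - s * \<sigma> * x + \<sigma>\<^sup>2)\<^sup>2 = x ^ 4 - 2 * s * \<sigma> * x ^ 3 + (s\<^sup>2 + 2) * \<sigma>\<^sup>2 * x\<^sup>2
       - 2 * s * \<sigma> ^ 3 * x ^ 1 + \<sigma> ^ 4" for x s :: real
      by (simp add: power2_eq_square power3_eq_cube power4_eq_xxxx algebra_simps)
    from this[of "\<bar>?X A\<bar>" "sqrt 6"] show "(\<bar>?X A\<bar>\<^sup>2 - sqrt 6 * \<sigma> * \<bar>?X A\<bar> + \<sigma>\<^sup>2)\<^sup>2 =
       \<bar>?X A\<bar> ^ 4 - 2 * sqrt 6 * \<sigma> * \<bar>?X A\<bar> ^ 3 + 8 * \<sigma>\<^sup>2 * \<bar>?X A\<bar>\<^sup>2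
       - 2 * sqrt 6 * \<sigma> ^ 3 * \<bar>?X A\<bar> ^ 1 + \<sigma> ^ 4" by simp
  qed
  also have "\<dots> = M 4 - 2 * sqrt 6 * \<sigma> * M 3 + 8 * \<sigma>\<^sup>2 * M 2 - 2 * sqrt 6 * \<sigma> ^ 3 * M 1 + 2 ^ card I * \<sigma> ^ 4"
    unfolding M_def using assms(1)
    by (simp only: sum.distrib sum_subtractf sum_distrib_left[symmetric]) (simp add: card_Pow)
  finally have "2 * sqrt 6 * \<sigma> * M 3 + sqrt 6 * \<sigma> * (\<sigma>\<^sup>2 * (2 * M 1)) \<le> 12 * \<sigma> ^ 4 * 2 ^ card I"
    using M4 unfolding M2 by (simp add: power2_eq_square power3_eq_cube power4_eq_xxxx algebra_simps)
  moreover have "sqrt 6 * \<sigma> * M 3 \<le> sqrt 6 * \<sigma> * (\<sigma>\<^sup>2 * (2 * M 1))"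
    using M31 \<sigma>(1) by (intro mult_left_mono) auto
  ultimately have "3 * sqrt 6 * \<sigma> * M 3 \<le> 12 * \<sigma> ^ 4 * 2 ^ card I" by linarith
  also have "12 * \<sigma> ^ 4 * 2 ^ card I = 3 * sqrt 6 * \<sigma> * (2 ^ card I * (sqrt (8 / 3) * \<sigma> ^ 3))"
  proof -
    have "sqrt 6 * sqrt (8 / 3) = 4" by (simp flip: real_sqrt_mult)
    then have "3 * (sqrt 6 * sqrt (8 / 3)) * \<sigma> ^ 4 * 2 ^ card I = 12 * \<sigma> ^ 4 * 2 ^ card I" by simp
    then show ?thesis by (simp add: power3_eq_cube power4_eq_xxxx ac_simps)
  qed
  finally show ?thesis using \<sigma>(1) unfolding M_def by (simp add: mult_le_cancel_left)
qed

text \<open>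
  The second moment lies between the \<open>p\<close>-th and the third one, so an upper bound on the third moment
  is a lower bound on the \<open>p\<close>-th. What matters is the rate at which the constant tends to 1 as \<open>p\<close>
  tends to 2.
\<close>

lemma Khinchine:
  fixes a :: "'a \<Rightarrow> real"
  assumes "finite I" and p: "0 < p" "p < 2"
  shows "(\<Sum>i\<in>I. (a i)\<^sup>2) powr (p / 2)
           \<le> (8 / 3) powr ((2 - p) / 2) * ((\<Sum>A\<in>Pow I. \<bar>sign_sum I a A\<bar> powr p) / 2 ^ card I)"
proof (cases "(\<Sum>i\<in>I. (a i)\<^sup>2) = 0")
  case True
  then show ?thesis by (simp add: sum_nonneg)
next
  case False
  let ?X = "sign_sum I a"
  define \<sigma> where "\<sigma> = sqrt (\<Sum>i\<in>I. (a i)\<^sup>2)"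
  have nn: "(\<Sum>i\<in>I. (a i)\<^sup>2) \<ge> 0" by (intro sum_nonneg) auto
  then have \<sigma>: "\<sigma> > 0" "\<sigma>\<^sup>2 = (\<Sum>i\<in>I. (a i)\<^sup>2)"
    using False by (auto simp: \<sigma>_def)
  define \<kappa> where "\<kappa> = sqrt (8 / 3 :: real)"
  have \<kappa>: "\<kappa> > 0" by (simp add: \<kappa>_def)
  \<comment> \<open>At this scale the bounds for the second and the third moment coincide, so that Young's
    inequality for the moments at scale \<open>\<tau>\<close> loses nothing.\<close>
  define \<tau> where "\<tau> = \<kappa> * \<sigma>"
  have \<tau>: "\<tau> > 0" using \<kappa> \<sigma> by (simp add: \<tau>_def)
  \<comment> \<open>The weight that solves \<open>2 = w * p + (1 - w) * 3\<close>.\<close>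
  define w where "w = 1 / (3 - p)"
  have w: "0 < w" "w < 1" "w * (3 - p) = 1" using p by (auto simp: w_def)
  define m where "m = (\<Sum>A\<in>Pow I. \<bar>?X A\<bar> powr p) / 2 ^ card I"
  have young: "(x / \<tau>)\<^sup>2 \<le> w * (x powr p / \<tau> powr p) + (1 - w) * (x ^ 3 / \<tau> ^ 3)" if "x \<ge> 0" for x
  proof -
    define u where "u = x / \<tau>"
    have u: "u \<ge> 0" using that \<tau> by (simp add: u_def)
    have "u\<^sup>2 \<le> w * u powr p + (1 - w) * u ^ 3"
    proof (cases "u = 0")
      case False
      then have u: "u > 0" using u by simp
      have "u\<^sup>2 = u powr (w * p + 3 * (1 - w))"
        using w(3) u by (simp add: algebra_simps powr_numeral)
      also have "\<dots> = (u powr p) powr w * (u ^ 3) powr (1 - w)"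
        using u by (simp add: powr_add powr_powr mult.commute flip: powr_numeral)
      also have "\<dots> \<le> w * u powr p + (1 - w) * u ^ 3"
        using w u by (intro Youngs_inequality_0) auto
      finally show ?thesis .
    qed auto
    then show ?thesis using that \<tau> by (simp add: u_def powr_divide power_divide)
  qed
  have "(\<Sum>A\<in>Pow I. (\<bar>?X A\<bar> / \<tau>)\<^sup>2)
      \<le> (\<Sum>A\<in>Pow I. w * (\<bar>?X A\<bar> powr p / \<tau> powr p) + (1 - w) * (\<bar>?X A\<bar> ^ 3 / \<tau> ^ 3))"
    by (intro sum_mono young) auto
  also have "\<dots> = w * ((\<Sum>A\<in>Pow I. \<bar>?X A\<bar> powr p) / \<tau> powr p) + (1 - w) * ((\<Sum>A\<in>Pow I. \<bar>?X A\<bar> ^ 3) / \<tau> ^ 3)"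
    by (simp add: sum.distrib sum_distrib_left sum_divide_distrib)
  also have "\<dots> \<le> w * ((\<Sum>A\<in>Pow I. \<bar>?X A\<bar> powr p) / \<tau> powr p) + (1 - w) * ((2 ^ card I * (\<kappa> * \<sigma> ^ 3)) / \<tau> ^ 3)"
    using sign_sum_third_moment[OF assms(1) \<sigma>] \<tau> w unfolding \<kappa>_def
    by (intro add_left_mono mult_left_mono divide_right_mono) auto
  also have "(\<Sum>A\<in>Pow I. (\<bar>?X A\<bar> / \<tau>)\<^sup>2) = 2 ^ card I * \<sigma>\<^sup>2 / \<tau>\<^sup>2"
    using sign_sum_second_moment[OF assms(1), of a]
    by (simp add: power_divide \<sigma>(2) flip: sum_divide_distrib)
  finally have "2 ^ card I * (\<sigma>\<^sup>2 / \<tau>\<^sup>2) \<le> 2 ^ card I * (w * (m / \<tau> powr p) + (1 - w) * (\<kappa> * \<sigma> ^ 3 / \<tau> ^ 3))"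
    by (simp add: m_def algebra_simps)
  then have "\<sigma>\<^sup>2 / \<tau>\<^sup>2 \<le> w * (m / \<tau> powr p) + (1 - w) * (\<kappa> * \<sigma> ^ 3 / \<tau> ^ 3)"
    by (rule mult_left_le_imp_le) simp
  moreover have "\<kappa> * \<sigma> ^ 3 / \<tau> ^ 3 = \<sigma>\<^sup>2 / \<tau>\<^sup>2"
    using \<kappa> \<sigma>(1) by (simp add: \<tau>_def power2_eq_square power3_eq_cube)
  moreover have "w * x \<le> w * y" if "x \<le> w * y + (1 - w) * x" for x y
    using that by (simp add: algebra_simps)
  ultimately have "w * (\<sigma>\<^sup>2 / \<tau>\<^sup>2) \<le> w * (m / \<tau> powr p)" by (simp only:)
  then have "\<sigma>\<^sup>2 / \<tau>\<^sup>2 \<le> m / \<tau> powr p" by (rule mult_left_le_imp_le) (use w in simp)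
  then have "\<tau> powr p * (1 / \<kappa>\<^sup>2) \<le> m"
    using \<tau> \<kappa> \<sigma>(1) by (simp add: \<tau>_def field_simps)
  then have "\<kappa>\<^sup>2 * (\<tau> powr p * (1 / \<kappa>\<^sup>2)) \<le> \<kappa>\<^sup>2 * m"
    by (intro mult_left_mono) auto
  then have "\<kappa> powr p * \<sigma> powr p \<le> \<kappa> powr 2 * m"
    using \<kappa> \<sigma>(1) by (simp add: \<tau>_def powr_mult)
  then have "\<sigma> powr p \<le> \<kappa> powr (2 - p) * m"
    using \<kappa> by (simp add: powr_diff field_simps)
  moreover have "\<sigma> powr p = (\<Sum>i\<in>I. (a i)\<^sup>2) powr (p / 2)" "\<kappa> powr (2 - p) = (8 / 3) powr ((2 - p) / 2)"
    using nn by (simp_all add: \<sigma>_def \<kappa>_def powr_powr flip: powr_half_sqrt)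
  ultimately show ?thesis by (simp add: m_def)
qed

section \<open>Mixed norms and their interpolation\<close>

definition index_lists :: "nat \<Rightarrow> nat \<Rightarrow> nat list set" where
  "index_lists N n = {is. length is = n \<and> set is \<subseteq> {..<N}}"

lemma index_lists_0 [simp]: "index_lists N 0 = {[]}"
  by (auto simp: index_lists_def)

lemma finite_index_lists [simp]: "finite (index_lists N n)"
  using finite_lists_length_eq[of "{..<N}" n] by (simp add: index_lists_def conj_commute)

lemma sum_index_lists_Suc:
  fixes f :: "nat list \<Rightarrow> real"
  shows "(\<Sum>l\<in>index_lists N (Suc n). f l) = (\<Sum>i<N. \<Sum>l\<in>index_lists N n. f (i # l))"
proof -
  have "index_lists N (Suc n) = (\<lambda>(i, l). i # l) ` ({..<N} \<times> index_lists N n)"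
    by (auto simp: index_lists_def length_Suc_conv image_iff)
  then have "(\<Sum>l\<in>index_lists N (Suc n). f l) = (\<Sum>(i, l)\<in>{..<N} \<times> index_lists N n. f (i # l))"
    by (simp add: sum.reindex inj_on_def case_prod_beta)
  then show ?thesis by (simp add: sum.cartesian_product)
qed

text \<open>
  The norm of \<open>\<ell>\<^sub>p\<^sub>1(\<ell>\<^sub>p\<^sub>2(\<dots>))\<close> of an array \<open>a\<close>, with the exponent of the first index outermost.
\<close>

fun mixed_norm :: "nat \<Rightarrow> real list \<Rightarrow> (nat list \<Rightarrow> real) \<Rightarrow> real" where
  "mixed_norm N [] a = \<bar>a []\<bar>"
| "mixed_norm N (p # ps) a = (\<Sum>i<N. mixed_norm N ps (\<lambda>l. a (i # l)) powr p) powr (1 / p)"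

lemma mixed_norm_nonneg [simp]: "mixed_norm N ps a \<ge> 0"
  by (cases ps) auto

lemma mixed_norm_replicate:
  assumes "p > 0"
  shows "mixed_norm N (replicate n p) a = (\<Sum>l\<in>index_lists N n. \<bar>a l\<bar> powr p) powr (1 / p)"
proof (induction n arbitrary: a)
  case 0
  then show ?case using assms by (simp add: powr_powr)
next
  case (Suc n)
  have "mixed_norm N (replicate n p) b powr p = (\<Sum>l\<in>index_lists N n. \<bar>b l\<bar> powr p)" for b
    using assms by (simp add: Suc powr_powr sum_nonneg)
  then show ?case by (simp add: sum_index_lists_Suc)
qed

definition insert_at :: "nat \<Rightarrow> 'a \<Rightarrow> 'a list \<Rightarrow> 'a list" where
  "insert_at j x xs = take j xs @ x # drop j xs"

text \<open>
  On the right the exponent 2 is innermost; Minkowski's inequality moves it outwards past the last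
  \<open>n - j\<close> indices, which have the smaller exponent \<open>p\<close>. This puts the \<open>n + 1\<close> norms, one for each place
  of the exponent 2, into the common order of indices that interpolation needs.
\<close>

lemma mixed_norm_insert_2_le:
  assumes p: "0 < p" "p < 2" and "j \<le> n"
  shows "mixed_norm N (insert_at j 2 (replicate n p)) a powr p
           \<le> (\<Sum>l\<in>index_lists N n. (\<Sum>i<N. (a (insert_at j i l))\<^sup>2) powr (p / 2))"
  using assms(3)
proof (induction j arbitrary: n a)
  case 0
  define F where "F i l = \<bar>a (i # l)\<bar> powr p" for i l
  have eq: "mixed_norm N (replicate n p) b powr 2 = (\<Sum>l\<in>index_lists N n. \<bar>b l\<bar> powr p) powr (2 / p)" for b
    unfolding mixed_norm_replicate[OF p(1)] by (simp add: powr_powr)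
  have "mixed_norm N (insert_at 0 2 (replicate n p)) a powr p
      = (\<Sum>i<N. (\<Sum>l\<in>index_lists N n. F i l) powr (2 / p)) powr (1 / (2 / p))"
    by (simp add: insert_at_def eq F_def powr_powr)
  also have "\<dots> \<le> (\<Sum>l\<in>index_lists N n. (\<Sum>i<N. F i l powr (2 / p)) powr (1 / (2 / p)))"
    using p by (intro Minkowski_powr) (auto simp: F_def)
  also have "\<dots> = (\<Sum>l\<in>index_lists N n. (\<Sum>i<N. (a (insert_at 0 i l))\<^sup>2) powr (p / 2))"
    using p by (simp add: F_def insert_at_def powr_powr powr_numeral)
  finally show ?case .
next
  case (Suc j)
  then obtain m where m: "n = Suc m" "j \<le> m" by (cases n) auto
  have "mixed_norm N (insert_at (Suc j) 2 (replicate n p)) a powr p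
      = (\<Sum>i<N. mixed_norm N (insert_at j 2 (replicate m p)) (\<lambda>l. a (i # l)) powr p)"
    using p by (simp add: m insert_at_def powr_powr sum_nonneg)
  also have "\<dots> \<le> (\<Sum>i<N. \<Sum>l\<in>index_lists N m. (\<Sum>k<N. (a (i # insert_at j k l))\<^sup>2) powr (p / 2))"
    by (intro sum_mono Suc.IH m)
  also have "\<dots> = (\<Sum>l\<in>index_lists N n. (\<Sum>k<N. (a (insert_at (Suc j) k l))\<^sup>2) powr (p / 2))"
    by (simp add: m sum_index_lists_Suc insert_at_def)
  finally show ?case .
qed

text \<open>
  Hoelder's inequality for mixed norms, by induction on the number of indices: the inner norms are
  compared by the induction hypothesis, and the outermost sum by Hoelder's inequality with the
  weights \<open>w j * r / p j\<close>.
\<close>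

lemma mixed_norm_interpolation:
  fixes w :: "'a \<Rightarrow> real" and P :: "'a \<Rightarrow> real list"
  assumes "finite J" and w: "\<And>j. j \<in> J \<Longrightarrow> w j > 0"
    and "\<And>j. j \<in> J \<Longrightarrow> length (P j) = length rs"
    and "\<And>j k. j \<in> J \<Longrightarrow> k < length rs \<Longrightarrow> P j ! k > 0"
    and "\<And>k. k < length rs \<Longrightarrow> rs ! k > 0 \<and> 1 / rs ! k = (\<Sum>j\<in>J. w j / P j ! k)"
    and w1: "(\<Sum>j\<in>J. w j) = 1"
  shows "mixed_norm N rs a \<le> (\<Prod>j\<in>J. mixed_norm N (P j) a powr w j)"
  using assms(3-5)
proof (induction rs arbitrary: P a)
  case Nil
  have "(\<Prod>j\<in>J. mixed_norm N (P j) a powr w j) = (\<Prod>j\<in>J. \<bar>a []\<bar> powr w j)"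
    using Nil by (intro prod.cong) auto
  also have "\<dots> = \<bar>a []\<bar>"
  proof (cases "a [] = 0")
    case True
    have "J \<noteq> {}" using w1 by auto
    then show ?thesis using True assms(1) by (auto intro!: prod_zero)
  next
    case False
    then show ?thesis using w1 powr_sum[of "\<bar>a []\<bar>" w J] assms(1) by simp
  qed
  finally show ?case by simp
next
  case (Cons r rs)
  define p where "p j = hd (P j)" for j
  define Q where "Q j = tl (P j)" for j
  have P: "P j = p j # Q j" if "j \<in> J" for j
    using Cons.prems(1)[OF that] by (cases "P j") (auto simp: p_def Q_def)
  have p: "p j > 0" if "j \<in> J" for j using Cons.prems(2)[OF that, of 0] P[OF that] by simp
  have r: "r > 0" "1 / r = (\<Sum>j\<in>J. w j / p j)"
    using Cons.prems(3)[of 0] P by (simp_all cong: sum.cong)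
  define G where "G j i = mixed_norm N (Q j) (\<lambda>l. a (i # l))" for i j
  have IH: "mixed_norm N rs b \<le> (\<Prod>j\<in>J. mixed_norm N (Q j) b powr w j)" for b
  proof (rule Cons.IH)
    show "length (Q j) = length rs" if "j \<in> J" for j using Cons.prems(1)[OF that] P[OF that] by simp
    show "Q j ! k > 0" if "j \<in> J" "k < length rs" for j k
      using Cons.prems(2)[OF that(1), of "Suc k"] P[OF that(1)] that by simp
    show "rs ! k > 0 \<and> 1 / rs ! k = (\<Sum>j\<in>J. w j / Q j ! k)" if "k < length rs" for k
      using Cons.prems(3)[of "Suc k"] P that by (simp cong: sum.cong)
  qed
  define v where "v j = w j / p j * r" for j
  have v: "v j > 0" if "j \<in> J" for j using w p r that by (simp add: v_def)
  have v1: "(\<Sum>j\<in>J. v j) = 1"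
  proof -
    have "(\<Sum>j\<in>J. v j) = (\<Sum>j\<in>J. w j / p j) * r" by (simp add: v_def sum_distrib_right)
    also have "\<dots> = 1 / r * r" by (simp only: r(2))
    finally show ?thesis using r(1) by simp
  qed
  have "(\<Sum>i<N. mixed_norm N rs (\<lambda>l. a (i # l)) powr r) \<le> (\<Sum>i<N. (\<Prod>j\<in>J. G j i powr w j) powr r)"
    unfolding G_def using r by (intro sum_mono powr_mono2 IH) auto
  also have "\<dots> = (\<Sum>i<N. \<Prod>j\<in>J. (G j i powr p j) powr v j)"
  proof (intro sum.cong refl)
    fix i
    have "(\<Prod>j\<in>J. G j i powr w j) powr r = (\<Prod>j\<in>J. (G j i powr w j) powr r)"
      by (rule prod_powr_distrib)
    also have "\<dots> = (\<Prod>j\<in>J. (G j i powr p j) powr v j)"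
      by (intro prod.cong refl) (use p in \<open>force simp: powr_powr v_def\<close>)
    finally show "(\<Prod>j\<in>J. G j i powr w j) powr r = (\<Prod>j\<in>J. (G j i powr p j) powr v j)" .
  qed
  also have "\<dots> \<le> (\<Prod>j\<in>J. (\<Sum>i<N. G j i powr p j) powr v j)"
    by (intro Hoelder_prod assms(1) v v1) auto
  finally have "mixed_norm N (r # rs) a \<le> (\<Prod>j\<in>J. (\<Sum>i<N. G j i powr p j) powr v j) powr (1 / r)"
    unfolding mixed_norm.simps using r(1) by (intro powr_mono2 sum_nonneg) auto
  also have "\<dots> = (\<Prod>j\<in>J. ((\<Sum>i<N. G j i powr p j) powr v j) powr (1 / r))"
    by (rule prod_powr_distrib)
  also have "\<dots> = (\<Prod>j\<in>J. mixed_norm N (P j) a powr w j)"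
    using r(1) by (intro prod.cong refl) (simp add: P G_def v_def powr_powr)
  finally show ?case .
qed

lemma nth_insert_at_replicate:
  assumes "j \<le> n" "k \<le> n"
  shows "insert_at j x (replicate n p) ! k = (if k = j then x else p)"
  using assms by (auto simp: insert_at_def nth_append nth_Cons')

lemma sum_insert_at_replicate:
  fixes p :: real
  assumes "k \<le> n"
  shows "(\<Sum>j\<le>n. 1 / (insert_at j 2 (replicate n p) ! k)) = real n / p + 1 / 2"
proof -
  have "(\<Sum>j\<le>n. 1 / (insert_at j 2 (replicate n p) ! k)) = (\<Sum>j\<le>n. if k = j then 1 / 2 else 1 / p)"
    by (intro sum.cong) (auto simp: nth_insert_at_replicate assms)
  also have "\<dots> = 1 / 2 + (\<Sum>j\<in>{..n} - {k}. 1 / p)"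
    using assms by (subst sum.remove[of _ k]) (auto intro!: sum.cong)
  also have "\<dots> = real n / p + 1 / 2" using assms by simp
  finally show ?thesis .
qed

text \<open>
  Each of the \<open>n + 1\<close> mixed norms has reciprocal exponent \<open>1 / 2\<close> at one index and
  \<open>1 / p = (n + 1) / (2 * n)\<close> at the \<open>n\<close> others. At every index the average over the mixed norms is
  \<open>(n + 2) / (2 * (n + 1)) = 1 / r\<close>, so their geometric mean dominates the \<open>\<ell>\<^sub>r\<close> norm.
\<close>

lemma mixed_to_BH_exponent:
  fixes n :: nat
  defines "p \<equiv> 2 * real n / (real n + 1)" and "r \<equiv> 2 * real (Suc n) / (real (Suc n) + 1)"
  assumes "n \<ge> 1" and "B \<ge> 0"
    and B: "\<And>j. j \<le> n \<Longrightarrow>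
      (\<Sum>l\<in>index_lists N n. (\<Sum>i<N. (a (insert_at j i l))\<^sup>2) powr (p / 2)) \<le> B powr p"
  shows "(\<Sum>l\<in>index_lists N (Suc n). \<bar>a l\<bar> powr r) powr (1 / r) \<le> B"
proof -
  have p: "0 < p" "p < 2" and r: "r > 0" using assms(3) by (auto simp: p_def r_def field_simps)
  define P where "P j = insert_at j 2 (replicate n p)" for j
  define w where "w = 1 / (real n + 1)"
  have "(\<Sum>l\<in>index_lists N (Suc n). \<bar>a l\<bar> powr r) powr (1 / r) = mixed_norm N (replicate (Suc n) r) a"
    by (rule mixed_norm_replicate[OF r, symmetric])
  also have "\<dots> \<le> (\<Prod>j\<le>n. mixed_norm N (P j) a powr w)"
  proof (rule mixed_norm_interpolation)
    show "length (P j) = length (replicate (Suc n) r)" if "j \<in> {..n}" for j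
      using that by (simp add: P_def insert_at_def)
    show "P j ! k > 0" if "j \<in> {..n}" "k < length (replicate (Suc n) r)" for j k
      using that p by (simp add: P_def nth_insert_at_replicate)
    show "replicate (Suc n) r ! k > 0 \<and> 1 / replicate (Suc n) r ! k = (\<Sum>j\<le>n. w / P j ! k)"
      if "k < length (replicate (Suc n) r)" for k
    proof -
      have "(\<Sum>j\<le>n. w / P j ! k) = w * (\<Sum>j\<le>n. 1 / P j ! k)" by (simp add: sum_distrib_left)
      also have "\<dots> = w * (real n / p + 1 / 2)"
        using that unfolding P_def by (subst sum_insert_at_replicate) auto
      also have "real n / p = (real n + 1) / 2"
        using assms(3) by (simp add: p_def)
      also have "w * ((real n + 1) / 2 + 1 / 2) = 1 / r"
        by (simp add: w_def r_def field_simps)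
      finally show ?thesis using r that by (simp add: nth_append del: replicate_Suc)
    qed
  qed (auto simp: w_def)
  also have "\<dots> \<le> (\<Prod>j\<le>n. B powr w)"
  proof (rule prod_mono, safe)
    fix j assume j: "j \<le> n"
    have "mixed_norm N (P j) a powr p \<le> B powr p"
      using mixed_norm_insert_2_le[OF p j] B[OF j] unfolding P_def by (rule order_trans)
    then have "mixed_norm N (P j) a \<le> B"
      using powr_less_mono2[OF p(1) assms(4), of "mixed_norm N (P j) a"] by linarith
    then show "mixed_norm N (P j) a powr w \<le> B powr w"
      by (intro powr_mono2) (auto simp: w_def)
  qed auto
  also have "\<dots> = B"
  proof (cases "B = 0")
    case False
    have "(\<Prod>j\<le>n. B powr w) = (B powr w) ^ Suc n" by simp
    also have "\<dots> = B powr (real (Suc n) * w)" using False by (rule powr_power)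
    also have "real (Suc n) * w = 1" by (simp add: w_def)
    finally show ?thesis using assms(4) by simp
  qed simp
  finally show ?thesis .
qed

section \<open>Multilinear forms and sign vectors\<close>

lemma insert_at_list_update:
  assumes "j \<le> length zs"
  shows "insert_at j e (zs[k := x]) = (insert_at j e zs)[if k < j then k else Suc k := x]"
proof (cases "k < j")
  case True
  then show ?thesis
    using assms by (simp add: insert_at_def take_update_swap list_update_append1)
next
  case False
  then have "Suc k - length (take j zs) = Suc (k - j)" "\<not> Suc k < length (take j zs)"
    using assms by auto
  with False show ?thesis
    using Suc_diff_le[of j k] by (simp add: insert_at_def drop_update_swap list_update_append)
qed

lemma insert_at_update_self:
  assumes "j \<le> length zs"
  shows "(insert_at j y zs)[j := x] = insert_at j x zs"
  using assms by (simp add: insert_at_def list_update_append)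

lemma map_insert_at: "map f (insert_at j i l) = insert_at j (f i) (map f l)"
  by (simp add: insert_at_def take_map drop_map)

lemma length_insert_at [simp]: "length (insert_at j x xs) = Suc (length xs)"
  by (simp add: insert_at_def)

lemma set_insert_at [simp]: "set (insert_at j x xs) = insert x (set xs)"
  unfolding insert_at_def by (metis Un_insert_right append_take_drop_id list.simps(15) set_append)

text \<open>
  The closed unit ball, which contains the basis vectors and the sign vectors, unlike the open one.
\<close>

definition cube :: "nat \<Rightarrow> real vec set" where
  "cube N = {x \<in> carrier_vec N. \<forall>i<N. \<bar>x $ i\<bar> \<le> 1}"

lemma multilinear_slot:
  assumes "multilinear_form n N U" "zs \<in> vec_tuples n N" "k < n" "x \<in> carrier_vec N" "y \<in> carrier_vec N"
  shows "U (zs[k := a \<cdot>\<^sub>v x + b \<cdot>\<^sub>v y]) = a * U (zs[k := x]) + b * U (zs[k := y])"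
  using assms unfolding multilinear_form_def by blast

lemma multilinear_slot_smult:
  assumes "multilinear_form n N U" "zs \<in> vec_tuples n N" "k < n" "x \<in> carrier_vec N"
  shows "U (zs[k := a \<cdot>\<^sub>v x]) = a * U (zs[k := x])"
proof -
  have "a \<cdot>\<^sub>v x + 0 \<cdot>\<^sub>v x = a \<cdot>\<^sub>v x" using assms(4) by auto
  then show ?thesis using multilinear_slot[OF assms(1-4,4), of a 0] by simp
qed

lemma multilinear_slot_expansion:
  assumes U: "multilinear_form n N U" "zs \<in> vec_tuples n N" "k < n" and x: "x \<in> carrier_vec N"
  shows "U (zs[k := x]) = (\<Sum>i<N. x $ i * U (zs[k := unit_vec N i]))"
proof -
  define t where "t m = vec N (\<lambda>i. if i < m then x $ i else 0)" for m
  have "m \<le> N \<Longrightarrow> U (zs[k := t m]) = (\<Sum>i<m. x $ i * U (zs[k := unit_vec N i]))" for m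
  proof (induction m)
    case 0
    have "t 0 = 0 \<cdot>\<^sub>v x" using x by (auto simp: t_def)
    then show ?case using multilinear_slot_smult[OF U x, of 0] by simp
  next
    case (Suc m)
    have "t (Suc m) = 1 \<cdot>\<^sub>v t m + (x $ m) \<cdot>\<^sub>v unit_vec N m"
      using Suc.prems by (auto simp: t_def less_Suc_eq)
    then have "U (zs[k := t (Suc m)]) = 1 * U (zs[k := t m]) + x $ m * U (zs[k := unit_vec N m])"
      by (simp only:) (rule multilinear_slot[OF U], auto simp: t_def)
    with Suc show ?case by simp
  qed
  from this[of N] have "U (zs[k := t N]) = (\<Sum>i<N. x $ i * U (zs[k := unit_vec N i]))" by simp
  moreover have "t N = x" using x by (auto simp: t_def)
  ultimately show ?thesis by simp
qed

text \<open>
  Expanding one slot after the other in the basis reduces the claim to the finitely many tuples of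
  basis vectors. The induction on \<open>k\<close> covers the tuples that are arbitrary in the first \<open>k\<close> slots and
  consist of basis vectors in the others.
\<close>

lemma multilinear_form_bounded:
  assumes U: "multilinear_form n N U"
  shows "\<exists>B. \<forall>zs. length zs = n \<and> set zs \<subseteq> cube N \<longrightarrow> \<bar>U zs\<bar> \<le> B"
proof -
  let ?E = "unit_vec N ` {..<N} :: real vec set"
  have E: "?E \<subseteq> cube N" by (auto simp: cube_def)
  have "k \<le> n \<Longrightarrow> \<exists>B. \<forall>zs. length zs = n \<and> set zs \<subseteq> cube N \<and> (\<forall>i<n. k \<le> i \<longrightarrow> zs ! i \<in> ?E)
          \<longrightarrow> \<bar>U zs\<bar> \<le> B" for k
  proof (induction k)
    case 0
    let ?Z = "{zs. set zs \<subseteq> ?E \<and> length zs = n}"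
    have "finite ?Z" by (intro finite_lists_length_eq) auto
    then have le: "\<bar>U zs\<bar> \<le> (\<Sum>zs\<in>?Z. \<bar>U zs\<bar>)" if "zs \<in> ?Z" for zs
      using that by (intro member_le_sum) auto
    show ?case
    proof (intro exI allI impI)
      fix zs :: "real vec list"
      assume "length zs = n \<and> set zs \<subseteq> cube N \<and> (\<forall>i<n. 0 \<le> i \<longrightarrow> zs ! i \<in> ?E)"
      then have "zs \<in> ?Z" unfolding mem_Collect_eq by (metis in_set_conv_nth subsetI le0)
      then show "\<bar>U zs\<bar> \<le> (\<Sum>zs\<in>?Z. \<bar>U zs\<bar>)" by (rule le)
    qed
  next
    case (Suc k)
    then obtain B where B: "\<And>zs. \<lbrakk>length zs = n; set zs \<subseteq> cube N; \<forall>i<n. k \<le> i \<longrightarrow> zs ! i \<in> ?E\<rbrakk> \<Longrightarrow> \<bar>U zs\<bar> \<le> B"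
      by auto
    have "\<bar>U zs\<bar> \<le> real N * B"
      if zs: "length zs = n" "set zs \<subseteq> cube N" "\<forall>i<n. Suc k \<le> i \<longrightarrow> zs ! i \<in> ?E" for zs
    proof -
      have vt: "zs \<in> vec_tuples n N" using zs by (auto simp: vec_tuples_def cube_def)
      have mem: "zs ! k \<in> cube N" using zs Suc.prems by (metis Suc_le_lessD nth_mem subsetD)
      then have c: "zs ! k \<in> carrier_vec N" by (simp add: cube_def)
      have "\<bar>U zs\<bar> = \<bar>\<Sum>i<N. zs ! k $ i * U (zs[k := unit_vec N i])\<bar>"
        using multilinear_slot_expansion[OF U vt _ c, of k] Suc.prems by simp
      also have "\<dots> \<le> (\<Sum>i<N. \<bar>zs ! k $ i * U (zs[k := unit_vec N i])\<bar>)" by (rule sum_abs)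
      also have "\<dots> \<le> (\<Sum>i<N. B)"
      proof (rule sum_mono)
        fix i assume i: "i \<in> {..<N}"
        have "\<bar>U (zs[k := unit_vec N i])\<bar> \<le> B"
        proof (rule B)
          show "set (zs[k := unit_vec N i]) \<subseteq> cube N"
            using set_update_subset_insert[of zs k] zs(2) E i by blast
          show "\<forall>m<n. k \<le> m \<longrightarrow> zs[k := unit_vec N i] ! m \<in> ?E"
            using zs i by (auto simp: nth_list_update)
        qed (use zs in simp)
        moreover have "\<bar>zs ! k $ i\<bar> \<le> 1" using mem i by (auto simp: cube_def)
        ultimately show "\<bar>zs ! k $ i * U (zs[k := unit_vec N i])\<bar> \<le> B"
          unfolding abs_mult using mult_right_mono[of "\<bar>zs ! k $ i\<bar>" 1 "\<bar>U (zs[k := unit_vec N i])\<bar>"] by simp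
      qed
      finally show ?thesis by simp
    qed
    then show ?case by blast
  qed
  from this[of n] show ?thesis by auto
qed

lemma open_unit_ball_iff:
  assumes "N > 0"
  shows "z \<in> open_unit_ball N \<longleftrightarrow> z \<in> carrier_vec N \<and> (\<forall>i<N. \<bar>z $ i\<bar> < 1)"
proof (cases "z \<in> carrier_vec N")
  case True
  then have dim: "dim_vec z = N" by simp
  have "(\<lambda>i. \<bar>z $ i\<bar>) ` {..<N} \<noteq> {}" using assms by auto
  then have "sup_norm_vec z < 1 \<longleftrightarrow> (\<forall>i<N. \<bar>z $ i\<bar> < 1)"
    unfolding sup_norm_vec_def dim by (subst Max_less_iff) auto
  then show ?thesis using True by (simp add: open_unit_ball_def)
qed (simp add: open_unit_ball_def)

context
  fixes N :: nat
  assumes N: "N > 0"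
begin

lemma form_sup_upper:
  assumes "multilinear_form n N U" "length zs = n" "set zs \<subseteq> open_unit_ball N"
  shows "\<bar>U zs\<bar> \<le> form_sup n N U"
proof -
  obtain B where B: "\<And>zs. length zs = n \<and> set zs \<subseteq> cube N \<longrightarrow> \<bar>U zs\<bar> \<le> B"
    using multilinear_form_bounded[OF assms(1)] by auto
  have "open_unit_ball N \<subseteq> cube N" by (auto simp: open_unit_ball_iff[OF N] cube_def less_imp_le)
  then have "bdd_above ((\<lambda>zs. \<bar>U zs\<bar>) ` {zs. length zs = n \<and> set zs \<subseteq> open_unit_ball N})"
    using B by (intro bdd_aboveI2[of _ _ B]) blast
  then show ?thesis unfolding form_sup_def using assms(2,3) by (intro cSUP_upper) auto
qed

lemma zero_in_open_unit_ball: "set (replicate n (0\<^sub>v N)) \<subseteq> open_unit_ball N"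
  by (auto simp: open_unit_ball_iff[OF N])

lemma form_sup_nonneg:
  assumes "multilinear_form n N U"
  shows "form_sup n N U \<ge> 0"
  using form_sup_upper[OF assms _ zero_in_open_unit_ball] by fastforce

lemma form_sup_least:
  assumes "\<And>zs. length zs = n \<Longrightarrow> set zs \<subseteq> open_unit_ball N \<Longrightarrow> \<bar>U zs\<bar> \<le> S"
  shows "form_sup n N U \<le> S"
proof -
  have "replicate n (0\<^sub>v N) \<in> {zs. length zs = n \<and> set zs \<subseteq> open_unit_ball N}"
    using zero_in_open_unit_ball by simp
  then show ?thesis unfolding form_sup_def by (intro cSUP_least) (use assms in blast)+
qed

lemma multilinear_form_insert_at:
  assumes U: "multilinear_form (Suc n) N U" and e: "e \<in> carrier_vec N" and j: "j \<le> n"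
  shows "multilinear_form n N (\<lambda>zs. U (insert_at j e zs))"
  unfolding multilinear_form_def
proof (intro ballI allI impI)
  fix zs k and x y :: "real vec" and a b :: real
  assume zs: "zs \<in> vec_tuples n N" and k: "k < n" and xy: "x \<in> carrier_vec N" "y \<in> carrier_vec N"
  have "insert_at j e zs \<in> vec_tuples (Suc n) N" using zs e by (auto simp: vec_tuples_def)
  moreover have "(if k < j then k else Suc k) < Suc n" using k j by auto
  moreover have "j \<le> length zs" using zs j by (simp add: vec_tuples_def)
  ultimately show "U (insert_at j e (zs[k := a \<cdot>\<^sub>v x + b \<cdot>\<^sub>v y]))
      = a * U (insert_at j e (zs[k := x])) + b * U (insert_at j e (zs[k := y]))"
    using multilinear_slot[OF U _ _ xy] by (simp only: insert_at_list_update)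
qed

text \<open>
  A vector \<open>e\<close> on the boundary of the ball is approached by \<open>t \<cdot> e\<close> with \<open>t < 1\<close>; by homogeneity in
  one slot, no limit of the values of \<open>U\<close> has to be taken.
\<close>

lemma form_sup_insert_at_le:
  assumes U: "multilinear_form (Suc n) N U" and e: "e \<in> cube N" and j: "j \<le> n"
  shows "form_sup n N (\<lambda>zs. U (insert_at j e zs)) \<le> form_sup (Suc n) N U"
proof (rule form_sup_least)
  fix zs assume zs: "length zs = n" "set zs \<subseteq> open_unit_ball N"
  have ec: "e \<in> carrier_vec N" using e by (simp add: cube_def)
  show "\<bar>U (insert_at j e zs)\<bar> \<le> form_sup (Suc n) N U"
  proof (rule field_le_mult_one_interval)
    fix t :: real assume t: "0 < t" "t < 1"
    have vt: "insert_at j e zs \<in> vec_tuples (Suc n) N"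
      using zs ec by (auto simp: vec_tuples_def open_unit_ball_def)
    have "U (insert_at j (t \<cdot>\<^sub>v e) zs) = t * U (insert_at j e zs)"
      using multilinear_slot_smult[OF U vt _ ec, of j t] j zs by (simp add: insert_at_update_self)
    then have "t * \<bar>U (insert_at j e zs)\<bar> = \<bar>U (insert_at j (t \<cdot>\<^sub>v e) zs)\<bar>"
      using t by (simp add: abs_mult)
    also have "\<dots> \<le> form_sup (Suc n) N U"
    proof (rule form_sup_upper[OF U])
      have "\<bar>t * e $ i\<bar> < 1" if "i < N" for i
      proof -
        have "\<bar>t * e $ i\<bar> \<le> t * 1" unfolding abs_mult using e that t by (intro mult_mono) (auto simp: cube_def)
        then show ?thesis using t by simp
      qed
      then show "set (insert_at j (t \<cdot>\<^sub>v e) zs) \<subseteq> open_unit_ball N"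
        using zs ec by (auto simp: open_unit_ball_iff[OF N])
    qed (use zs in simp)
    finally show "t * \<bar>U (insert_at j e zs)\<bar> \<le> form_sup (Suc n) N U" .
  qed
qed

end

lemma coeff_norm_eq:
  "coeff_norm n N U = (\<Sum>l\<in>index_lists N n. \<bar>U (map (unit_vec N) l)\<bar> powr (2 * real n / (real n + 1)))
     powr (1 / (2 * real n / (real n + 1)))"
  by (simp add: coeff_norm_def index_lists_def)

definition sign_vec :: "nat \<Rightarrow> nat set \<Rightarrow> real vec" where
  "sign_vec N A = vec N (\<lambda>i. if i \<in> A then 1 else - 1)"

lemma sign_vec_in_cube: "sign_vec N A \<in> cube N"
  by (simp add: sign_vec_def cube_def)

lemma multilinear_form_sign_vec:
  assumes U: "multilinear_form (Suc n) N U" and l: "l \<in> index_lists N n" and j: "j \<le> n"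
  shows "U (insert_at j (sign_vec N A) (map (unit_vec N) l))
       = sign_sum {..<N} (\<lambda>i. U (map (unit_vec N) (insert_at j i l))) A"
proof -
  let ?zs = "insert_at j (sign_vec N A) (map (unit_vec N) l)"
  have "length l = n" using l by (simp add: index_lists_def)
  then have vt: "?zs \<in> vec_tuples (Suc n) N"
    using sign_vec_in_cube[of N A] by (auto simp: vec_tuples_def cube_def)
  have "U (?zs[j := sign_vec N A]) = (\<Sum>i<N. sign_vec N A $ i * U (?zs[j := unit_vec N i]))"
    using sign_vec_in_cube[of N A] j by (intro multilinear_slot_expansion[OF U vt]) (auto simp: cube_def)
  then show ?thesis using j \<open>length l = n\<close>
    unfolding sign_sum_def
    by (simp add: insert_at_update_self map_insert_at) (intro sum.cong, auto simp: sign_vec_def map_insert_at)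
qed

section \<open>The recursion for the optimal constants\<close>

text \<open>
  Inserting a sign vector into slot \<open>j\<close> leaves an \<open>n\<close>-linear form of no larger supremum, to which the
  inequality for \<open>n\<close> applies. Its coefficients are Rademacher sums of the coefficients of \<open>U\<close>, so that
  averaging over the signs and Khinchine's inequality bound a mixed norm with exponent 2 in slot \<open>j\<close>.
  Interpolation over all \<open>j\<close> finishes. The loss is the Khinchine constant
  \<open>(8 / 3) powr ((2 - p) / (2 * p))\<close>, and \<open>(2 - p) / p = 1 / n\<close>.
\<close>

lemma BH_inequality_Suc:
  assumes n: "n \<ge> 1" and C: "C \<ge> 0" "BH_inequality n C"
  shows "BH_inequality (Suc n) ((8 / 3) powr (1 / (2 * real n)) * C)"
  unfolding BH_inequality_def
proof (intro allI impI)
  fix N :: nat and U :: "real vec list \<Rightarrow> real"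
  assume N: "N > 0" and U: "multilinear_form (Suc n) N U"
  define p where "p = 2 * real n / (real n + 1)"
  have p: "0 < p" "p < 2" using n by (auto simp: p_def field_simps)
  define S where "S = form_sup (Suc n) N U"
  have S: "S \<ge> 0" unfolding S_def by (rule form_sup_nonneg[OF N U])
  define a where "a l = U (map (unit_vec N) l)" for l
  define X where "X j l = sign_sum {..<N} (\<lambda>i. a (insert_at j i l))" for j l
  define B where "B = (8 / 3) powr (1 / (2 * real n)) * C * S"
  have B: "B \<ge> 0" using C S by (simp add: B_def)
  have slice: "(\<Sum>l\<in>index_lists N n. \<bar>X j l A\<bar> powr p) \<le> (C * S) powr p" if j: "j \<le> n" for j A
  proof -
    define V where "V zs = U (insert_at j (sign_vec N A) zs)" for zs
    have V: "multilinear_form n N V"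
      unfolding V_def using sign_vec_in_cube[of N A]
      by (intro multilinear_form_insert_at[OF N U _ j]) (simp add: cube_def)
    have eq: "V (map (unit_vec N) l) = X j l A" if "l \<in> index_lists N n" for l
      unfolding V_def X_def a_def by (rule multilinear_form_sign_vec[OF U that j])
    have "coeff_norm n N V \<le> C * form_sup n N V"
      using C(2) N V by (simp add: BH_inequality_def)
    also have "\<dots> \<le> C * S"
      unfolding V_def S_def by (intro mult_left_mono C form_sup_insert_at_le[OF N U sign_vec_in_cube j])
    finally have "(\<Sum>l\<in>index_lists N n. \<bar>X j l A\<bar> powr p) powr (1 / p) \<le> C * S"
      unfolding coeff_norm_eq p_def[symmetric] by (simp add: eq cong: sum.cong)
    then have "((\<Sum>l\<in>index_lists N n. \<bar>X j l A\<bar> powr p) powr (1 / p)) powr p \<le> (C * S) powr p"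
      using p by (intro powr_mono2) auto
    then show ?thesis using p by (simp add: powr_powr sum_nonneg)
  qed
  have "(\<Sum>l\<in>index_lists N n. (\<Sum>i<N. (a (insert_at j i l))\<^sup>2) powr (p / 2)) \<le> B powr p"
    if j: "j \<le> n" for j
  proof -
    let ?\<kappa> = "(8 / 3) powr ((2 - p) / 2) :: real"
    have "(\<Sum>l\<in>index_lists N n. (\<Sum>i<N. (a (insert_at j i l))\<^sup>2) powr (p / 2))
        \<le> (\<Sum>l\<in>index_lists N n. ?\<kappa> * ((\<Sum>A\<in>Pow {..<N}. \<bar>X j l A\<bar> powr p) / 2 ^ card {..<N}))"
      unfolding X_def using p by (intro sum_mono Khinchine) auto
    also have "\<dots> = ?\<kappa> * ((\<Sum>A\<in>Pow {..<N}. \<Sum>l\<in>index_lists N n. \<bar>X j l A\<bar> powr p) / 2 ^ N)"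
      by (subst sum.swap) (simp add: sum_distrib_left sum_divide_distrib)
    also have "\<dots> \<le> ?\<kappa> * ((\<Sum>A\<in>Pow {..<N}. (C * S) powr p) / 2 ^ N)"
      by (intro mult_left_mono divide_right_mono sum_mono slice j) auto
    also have "\<dots> = ?\<kappa> * (C * S) powr p" by (simp add: card_Pow)
    also have "(2 - p) / 2 = 1 / (2 * real n) * p" using n by (simp add: p_def field_simps)
    also have "(8 / 3) powr (1 / (2 * real n) * p) * (C * S) powr p = B powr p"
      using C S by (simp add: B_def powr_mult powr_powr)
    finally show ?thesis .
  qed
  then have "coeff_norm (Suc n) N U \<le> B"
    unfolding coeff_norm_eq a_def[symmetric] p_def by (intro mixed_to_BH_exponent n B)
  then show "coeff_norm (Suc n) N U \<le> (8 / 3) powr (1 / (2 * real n)) * C * form_sup (Suc n) N U"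
    by (simp add: B_def S_def)
qed

text \<open>
  For a linear form the sum of the \<open>\<bar>a i\<bar>\<close> is the value at the sign vector of \<open>a\<close>.
\<close>

lemma BH_inequality_1: "BH_inequality 1 1"
  unfolding BH_inequality_def
proof (intro allI impI)
  fix N :: nat and U :: "real vec list \<Rightarrow> real"
  assume N: "N > 0" and "multilinear_form 1 N U"
  then have U: "multilinear_form (Suc 0) N U" by simp
  define a where "a i = U [unit_vec N i]" for i
  define A where "A = {i. a i \<ge> 0}"
  have "coeff_norm 1 N U = (\<Sum>i<N. \<bar>a i\<bar>)"
    by (simp add: coeff_norm_eq sum_index_lists_Suc a_def sum_nonneg)
  also have "\<dots> = sign_sum {..<N} a A"
    unfolding sign_sum_def A_def by (intro sum.cong) auto
  also have "\<dots> = U (insert_at 0 (sign_vec N A) [])"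
    using multilinear_form_sign_vec[OF U, of "[]" 0 A] by (simp add: a_def[abs_def] insert_at_def)
  also have "\<dots> \<le> form_sup 0 N (\<lambda>zs. U (insert_at 0 (sign_vec N A) zs))"
  proof -
    have "{zs :: real vec list. length zs = 0 \<and> set zs \<subseteq> open_unit_ball N} = {[]}" by auto
    then show ?thesis unfolding form_sup_def by (simp only: image_insert image_empty cSup_singleton abs_ge_self)
  qed
  also have "\<dots> \<le> form_sup (Suc 0) N U"
    by (intro form_sup_insert_at_le N U sign_vec_in_cube) auto
  finally show "coeff_norm 1 N U \<le> 1 * form_sup 1 N U" by simp
qed

lemma BH_inequality_mono:
  assumes "BH_inequality n C" "C \<le> D"
  shows "BH_inequality n D"
  unfolding BH_inequality_def
proof (intro allI impI)
  fix N :: nat and U :: "real vec list \<Rightarrow> real"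
  assume N: "N > 0" and U: "multilinear_form n N U"
  have "coeff_norm n N U \<le> C * form_sup n N U" using assms(1) N U by (simp add: BH_inequality_def)
  also have "\<dots> \<le> D * form_sup n N U"
    using assms(2) form_sup_nonneg[OF N U] by (intro mult_right_mono)
  finally show "coeff_norm n N U \<le> D * form_sup n N U" .
qed

text \<open>
  The partial sum \<open>1 + 1 + 1 / 2 + 1 / 6\<close> of the exponential series is exactly \<open>8 / 3\<close>.
\<close>

lemma exp_1_ge: "8 / 3 \<le> exp (1 :: real)"
proof -
  have "(\<Sum>n<4. (1::real) ^ n /\<^sub>R fact n) \<le> exp 1"
    unfolding exp_def by (rule sum_le_suminf[OF summable_exp_generic]) auto
  then show ?thesis by (simp add: eval_nat_numeral)
qed

text \<open>
  The factor in each step is at most \<open>exp (1 / (2 * (n + 1)))\<close>, which is at most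
  \<open>sqrt ((n + 1) / n)\<close> because \<open>1 - x \<le> exp (- x)\<close> for \<open>x = 1 / (n + 1)\<close>; the product telescopes.
\<close>

lemma BH_inequality_sqrt:
  assumes "n \<ge> 1"
  shows "BH_inequality (Suc n) (sqrt (exp 1 * real n))"
  using assms
proof (induction n rule: dec_induct)
  case base
  have "BH_inequality (Suc 1) ((8 / 3) powr (1 / (2 * real 1)) * 1)"
    by (rule BH_inequality_Suc) (use BH_inequality_1 in auto)
  moreover have "(8 / 3) powr (1 / (2 * real 1)) * 1 \<le> sqrt (exp 1 * real 1)"
    using exp_1_ge by (simp add: powr_half_sqrt)
  ultimately show ?case by (rule BH_inequality_mono)
next
  case (step n)
  have "BH_inequality (Suc (Suc n)) ((8 / 3) powr (1 / (2 * real (Suc n))) * sqrt (exp 1 * real n))"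
    by (rule BH_inequality_Suc) (use step in auto)
  moreover have "(8 / 3) powr (1 / (2 * real (Suc n))) * sqrt (exp 1 * real n) \<le> sqrt (exp 1 * real (Suc n))"
  proof -
    define x where "x = 1 / real (Suc n)"
    have "(8 / 3) powr (1 / (2 * real (Suc n))) \<le> exp 1 powr (x / 2)"
      using powr_mono2[OF _ _ exp_1_ge, of "x / 2"] by (simp add: x_def mult.commute)
    also have "\<dots> = sqrt (exp x)"
    proof -
      have "sqrt (exp x) = exp (x / 2)"
        by (rule real_sqrt_unique) (simp_all flip: exp_of_nat_mult)
      then show ?thesis by (simp add: powr_def)
    qed
    finally have "(8 / 3) powr (1 / (2 * real (Suc n))) * sqrt (exp 1 * real n)
        \<le> sqrt (exp x) * sqrt (exp 1 * real n)" by (intro mult_right_mono) auto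
    also have "\<dots> = sqrt (exp 1 * (exp x * real n))" by (simp add: real_sqrt_mult)
    also have "exp x * real n \<le> real (Suc n)"
    proof -
      have "real n = real (Suc n) * (1 - x)" by (simp add: x_def field_simps)
      also have "\<dots> \<le> real (Suc n) * exp (- x)"
        using exp_ge_add_one_self[of "- x"] by (intro mult_left_mono) auto
      finally have "exp x * real n \<le> exp x * (real (Suc n) * exp (- x))" by (intro mult_left_mono) auto
      also have "\<dots> = real (Suc n)" by (simp add: exp_minus)
      finally show ?thesis .
    qed
    finally show ?thesis by simp
  qed
  ultimately show ?case by (rule BH_inequality_mono)
qed

text \<open>
  The admissible constants form a closed half line, so the least one exists; without this,
  the value of \<^const>\<open>BH_const\<close> would be unspecified.
\<close>

lemma BH_const_bounds:
  assumes "1 \<le> C" "BH_inequality n C"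
  shows "1 \<le> BH_const n" "BH_const n \<le> C"
proof -
  define T where "T = {C. 1 \<le> C \<and> BH_inequality n C}"
  have C: "C \<in> T" using assms by (simp add: T_def)
  have bdd: "bdd_below T" by (auto simp: T_def intro: bdd_belowI[of _ 1])
  have le: "Inf T \<le> D" if "D \<in> T" for D using that bdd by (rule cInf_lower)
  have ge: "x \<le> Inf T" if "\<And>D. D \<in> T \<Longrightarrow> x \<le> D" for x using C that by (intro cInf_greatest) auto
  have one: "1 \<le> Inf T" by (rule ge) (simp add: T_def)
  have "BH_inequality n (Inf T)"
    unfolding BH_inequality_def
  proof (intro allI impI)
    fix N :: nat and U :: "real vec list \<Rightarrow> real"
    assume N: "N > 0" and U: "multilinear_form n N U"
    have D: "coeff_norm n N U \<le> D * form_sup n N U" if "D \<in> T" for D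
      using that N U by (simp add: T_def BH_inequality_def)
    show "coeff_norm n N U \<le> Inf T * form_sup n N U"
    proof (cases "form_sup n N U = 0")
      case True
      then show ?thesis using D[OF C] by simp
    next
      case False
      then have pos: "form_sup n N U > 0" using form_sup_nonneg[OF N U] by simp
      then have "coeff_norm n N U / form_sup n N U \<le> Inf T"
        by (intro ge) (simp add: divide_le_eq D)
      then show ?thesis using pos by (simp add: divide_le_eq)
    qed
  qed
  then have "BH_const n = Inf T"
    unfolding BH_const_def using one le by (intro Least_equality) (auto simp: T_def)
  then show "1 \<le> BH_const n" "BH_const n \<le> C" using one le[OF C] by auto
qed

lemma BH_const_le_sqrt:
  assumes "n \<ge> 1"
  shows "1 \<le> BH_const (Suc n)" "BH_const (Suc n) \<le> sqrt (exp 1 * real n)"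
proof -
  have "1 * 1 \<le> exp (1::real) * real n" using assms by (intro mult_mono) auto
  then have "1 \<le> sqrt (exp 1 * real n)" by simp
  from BH_const_bounds[OF this BH_inequality_sqrt[OF assms]]
  show "1 \<le> BH_const (Suc n)" "BH_const (Suc n) \<le> sqrt (exp 1 * real n)" by auto
qed

theorem mainTheorem4:
  shows "infinite {n :: nat. n > 0 \<and>
           BH_const (n + 1) - BH_const n < 0.87 / real n powr 0.473678}"
proof
  assume "finite {n :: nat. n > 0 \<and> BH_const (n + 1) - BH_const n < 0.87 / real n powr 0.473678}"
  then obtain m where m: "\<And>n. n > 0 \<Longrightarrow> BH_const (n + 1) - BH_const n < 0.87 / real n powr 0.473678 \<Longrightarrow> n \<le> m"
    using finite_nat_set_iff_bounded_le by (metis (no_types, lifting) mem_Collect_eq)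
  \<comment> \<open>Beyond \<open>m\<close> every increment is large; add up those between \<open>n\<close> and \<open>2 * n\<close>.\<close>
  have large: "sqrt (exp 1 * (2 * real n)) \<ge> real n * (0.87 / (2 * real n) powr 0.473678)" if n: "n > m" "n \<ge> 2" for n
  proof -
    define d where "d = 0.87 / (2 * real n) powr 0.473678"
    have "k \<le> n \<Longrightarrow> real k * d \<le> BH_const (n + k)" for k
    proof (induction k)
      case 0
      have "1 \<le> BH_const (Suc (n - 1))" by (rule BH_const_le_sqrt) (use n in simp)
      then show ?case using n by simp
    next
      case (Suc k)
      have "0.87 / real (n + k) powr 0.473678 \<le> BH_const (n + k + 1) - BH_const (n + k)"
        using m[of "n + k"] n by force
      moreover have "d \<le> 0.87 / real (n + k) powr 0.473678"
        unfolding d_def using Suc.prems n by (intro divide_left_mono powr_mono2) auto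
      ultimately show ?case using Suc by (simp add: algebra_simps)
    qed
    from this[of n] have "real n * d \<le> BH_const (Suc (2 * n - 1))"
      using n by (simp add: mult_2)
    also have "\<dots> \<le> sqrt (exp 1 * real (2 * n - 1))" using n by (intro BH_const_le_sqrt) auto
    also have "\<dots> \<le> sqrt (exp 1 * (2 * real n))" by (intro real_sqrt_le_mono mult_left_mono) auto
    finally show ?thesis by (simp add: d_def)
  qed
  have "eventually (\<lambda>n. sqrt (exp 1 * (2 * real n)) < real n * (0.87 / (2 * real n) powr 0.473678)) at_top"
    by real_asymp
  then have "eventually (\<lambda>n::nat. False) at_top"
    using eventually_gt_at_top[of m] eventually_ge_at_top[of 2]
    by eventually_elim (use large in force)
  then show False by simp
qed

end
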